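(* Fix $p\in[1,+\infty)$ and let $\alpha\in(0,1)$ be a given risk level. Suppose that the following two conditions hold. (Regression) For a.e. $x\in\mathcal X$, $z\in\mathcal Z$ and any risk level $\alpha'\in(0,1)$ there exist constants $\kappa_{p,n}(\alpha',x)>0$ and $\kappa_{p,n}(\alpha')>0$ (not depending on $z$) such that $$\mathbb P\{\|f^*(x,z)-\hat f_n(x,z)\|^p>\kappa_{p,n}^p(\alpha',x)\}\le\alpha',\qquad \mathbb P\Big\{\tfrac1n\sum_{k=1}^n\|f^*(x^k,z^k)-\hat f_n(x^k,z^k)\|^p>\kappa_{p,n}^p(\alpha')\Big\}\le\alpha'.$$ (Concentration) There exist constants $c_1,c_2,c_3>0$ (depending on $\alpha$, $p$ and $d_y$) such that for all $\kappa>0$, $n\in\mathbb N$, $x\in\mathcal X$, $z\in\mathcal Z$, $$\mathbb P\{d_{W,p}(P_n^*(x,z),P_{Y|X=x,Z=z})\ge\kappa\}\le c_1\exp(-c_2n\kappa^{c_3}).$$ Let the radius be $$\xi_n(\alpha,x):=\kappa_{p,n}(\tfrac{\alpha}{4},x)+\kappa_{p,n}(\tfrac{\alpha}{4})+\Big(\frac{\log(2c_1\alpha^{-1})}{c_2n}\Big)^{1/c_3}.$$ Then for a.e. $x\in\mathcal X$ and $z\in\mathcal Z$, the finite sample certificate guarantee $$\mathbb P\{g(\hat z_n^{D^3RO}(x),x)\le\hat v_n^{D^3RO}(x)\}\ge1-\alpha$$ holds for the ER-D$^3$RO problem under the Wasserstein ambiguity sets $\hat{\mathcal P}_n(x,z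;\xi_n(\alpha,x))$.
   Context: Setting. $X,Z,Y$ are random vectors with supports $\mathcal X\subseteq\mathbb R^{d_x}$, $\mathcal Z\subseteq\mathbb R^{d_z}$, $\mathcal Y\subseteq\mathbb R^{d_y}$, with $\mathcal Y$ nonempty closed convex and $\mathcal Z$ nonempty compact. $Y=f^*(X,Z)+\epsilon$, where $\epsilon$ has zero mean and is independent of $X$ and $Z$, and $f^*(x,z)=\mathbb E[Y|X=x,Z=z]$. Write $Y(x,z):=f^*(x,z)+\epsilon$; $P_{Y|X=x,Z=z}$ is the conditional distribution of $Y$ given $X=x,Z=z$ (the law of $Y(x,z)$). $c(z,Y)$ is a real-valued cost function. $\|\cdot\|$ is the $\ell_2$-norm. True problem: $v^*(x):=\min_{z\in\mathcal Z}g(z,x)$, $g(z,x):=\mathbb E_\epsilon[c(z,f^*(x,z)+\epsilon)]$, assumed well-defined and finite with nonempty optimal solution set $S^*(x)\subseteq\mathcal Z$. Data: $D_n=\{(x^k,z^k,y^k)\}_{k=1}^n$ are joint observations of $(X,Z,Y)$ (not necessarily i.i.d.); $\mathbb P$ is the probability measure generating them. $\hat f_n$ is a regression estimate of $f^*$ computed from $D_n$; $\epsilon^k:=y^k-f^*(x^k,z^k)$ and $\hat\epsilon_n^k:=y^k-\hat f_n(x^k,z^k)$. With $\delta_y$ the Dirac measure at $y$ and $\mathrm{proj}_{\mathcal Y}$ the orthogonal projection onto $\mathcal Y$, let $$P_n^*(x,z):=\tfrac1n\sum_{k=1}^n\delta_{f^*(x,z)+\epsilon^k},\qquad \hat P_n^{ER}(x,z):=\tfrac1n\sum_{k=1}^n\delta_{\mathrm{proj}_{\mathcal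 Y}(\hat f_n(x,z)+\hat\epsilon_n^k)}.$$ $d_{W,p}$ is the $p$-Wasserstein distance with reference distance $\|y_1-y_2\|$. For a radius $\xi\ge0$, $\hat{\mathcal P}_n(x,z;\xi):=\{Q\in\mathcal P(\mathcal Y):d_{W,p}(Q,\hat P_n^{ER}(x,z))\le\xi\}$, where $\mathcal P(\mathcal Y)$ is the set of probability distributions on $\mathcal Y$. ER-D$^3$RO problem with radius $\xi$: $\hat v_n^{D^3RO}(x):=\min_{z\in\mathcal Z}\sup_{Q\in\hat{\mathcal P}_n(x,z;\xi)}\mathbb E_{Y\sim Q}[c(z,Y)]$; its objective is assumed real-valued and lower semicontinuous on $\mathcal Z$ for each $x$, so an optimal solution, denoted $\hat z_n^{D^3RO}(x)$, exists.
   Formalization: The pointwise bound in (Regression) is assumed for every measurable data-dependent choice of z in Z, not only a.e. fixed z (the claim fails otherwise), and f*(x,z)+ε is assumed to lie in Y almost surely for all x in X, z in Z. *)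

theory Defs
  imports "HOL-Probability.Probability"
begin

definition rv_support :: "'s measure \<Rightarrow> ('s \<Rightarrow> 'a::topological_space) \<Rightarrow> 'a set" where
  "rv_support S X = {x. \<forall>U. open U \<longrightarrow> x \<in> U \<longrightarrow> 0 < measure (distr S borel X) U}"

definition couplings ::
  "'a::second_countable_topology measure \<Rightarrow> 'a measure \<Rightarrow> ('a \<times> 'a) measure set" where
  "couplings \<mu> \<nu> = {\<pi>. prob_space \<pi> \<and> sets \<pi> = sets (borel \<Otimes>\<^sub>M borel) \<and>
                        distr \<pi> borel fst = \<mu> \<and> distr \<pi> borel snd = \<nu>}"

text \<open>The real \<open>powr\<close> is not available on \<open>ennreal\<close>; the infinite case is kept infinite.\<close>

definition ennreal_root :: "real \<Rightarrow> ennreal \<Rightarrow> ennreal" where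
  "ennreal_root p t = (if t = \<infinity> then \<infinity> else ennreal (enn2real t powr (1 / p)))"

text \<open>The value \<open>\<infinity>\<close> is possible, since no moment conditions are imposed.\<close>

definition wasserstein ::
  "real \<Rightarrow> 'a::euclidean_space measure \<Rightarrow> 'a measure \<Rightarrow> ennreal" where
  "wasserstein p \<mu> \<nu> = ennreal_root p
     (INF \<pi>\<in>couplings \<mu> \<nu>. \<integral>\<^sup>+(y1, y2). ennreal (norm (y1 - y2) powr p) \<partial>\<pi>)"

text \<open>Extended expectation \<open>E[h\<^sup>+] - E[h\<^sup>-]\<close>.  The arithmetic of \<open>ereal\<close> gives
  \<open>\<infinity> - \<infinity> = \<infinity>\<close>, so a finite supremum of such expectations excludes undefined ones.\<close>

definition ext_expectation :: "'a measure \<Rightarrow> ('a \<Rightarrow> real) \<Rightarrow> ereal" where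
  "ext_expectation Q h =
     enn2ereal (\<integral>\<^sup>+y. ennreal (h y) \<partial>Q) - enn2ereal (\<integral>\<^sup>+y. ennreal (- h y) \<partial>Q)"

definition prob_on :: "'a::topological_space set \<Rightarrow> 'a measure set" where
  "prob_on A = {Q. prob_space Q \<and> sets Q = sets borel \<and> emeasure Q A = 1}"

text \<open>The measure \<open>(1/n) (\<delta>(y 1) + ... + \<delta>(y n))\<close>, as the image of the uniform distribution
  on the indices.\<close>

definition empirical :: "nat \<Rightarrow> (nat \<Rightarrow> 'a::topological_space) \<Rightarrow> 'a measure" where
  "empirical n y = distr (uniform_count_measure {1..n}) borel y"

text \<open>A sample of size \<open>n\<close> is an extensional family of triples \<open>(x, z, y)\<close> indexed by
  \<open>{1..n}\<close>.\<close>

type_synonym ('x, 'z, 'y) obs = "(real^'x) \<times> (real^'z) \<times> (real^'y)"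
type_synonym ('x, 'z, 'y) sample = "nat \<Rightarrow> ('x, 'z, 'y) obs"

definition sample_space :: "nat \<Rightarrow> ('x::finite, 'z::finite, 'y::finite) sample measure" where
  "sample_space n = Pi\<^sub>M {1..n} (\<lambda>_. borel)"

definition sample_of :: "nat \<Rightarrow> (nat \<Rightarrow> 'w \<Rightarrow> ('x, 'z, 'y) obs) \<Rightarrow> 'w \<Rightarrow> ('x, 'z, 'y) sample" where
  "sample_of n D \<omega> = (\<lambda>k\<in>{1..n}. D k \<omega>)"

abbreviation obs_x :: "('x, 'z, 'y) obs \<Rightarrow> real^'x" where "obs_x o1 \<equiv> fst o1"
abbreviation obs_z :: "('x, 'z, 'y) obs \<Rightarrow> real^'z" where "obs_z o1 \<equiv> fst (snd o1)"
abbreviation obs_y :: "('x, 'z, 'y) obs \<Rightarrow> real^'y" where "obs_y o1 \<equiv> snd (snd o1)"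

definition residual ::
  "(real^'x \<Rightarrow> real^'z \<Rightarrow> real^'y) \<Rightarrow> ('x, 'z, 'y) sample \<Rightarrow> nat \<Rightarrow> real^'y" where
  "residual f d k = obs_y (d k) - f (obs_x (d k)) (obs_z (d k))"

definition P_star ::
  "(real^'x \<Rightarrow> real^'z \<Rightarrow> real^'y) \<Rightarrow> nat \<Rightarrow> ('x, 'z, 'y) sample \<Rightarrow>
   real^'x \<Rightarrow> real^'z \<Rightarrow> (real^'y) measure" where
  "P_star fstar n d x z = empirical n (\<lambda>k. fstar x z + residual fstar d k)"

text \<open>In the following definitions \<open>fhat\<close> is the estimate computed from samples of size \<open>n\<close>:
  \<open>fhat d\<close> is the fitted regression function.\<close>

definition P_ER ::
  "(real^'y) set \<Rightarrow> (('x, 'z, 'y) sample \<Rightarrow> real^'x \<Rightarrow> real^'z \<Rightarrow> real^'y) \<Rightarrow> nat \<Rightarrow>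
   ('x, 'z, 'y) sample \<Rightarrow> real^'x \<Rightarrow> real^'z \<Rightarrow> (real^'y) measure" where
  "P_ER YY fhat n d x z =
     empirical n (\<lambda>k. closest_point YY (fhat d x z + residual (fhat d) d k))"

definition ambiguity_set ::
  "real \<Rightarrow> (real^'y) set \<Rightarrow> (('x, 'z, 'y) sample \<Rightarrow> real^'x \<Rightarrow> real^'z \<Rightarrow> real^'y) \<Rightarrow> nat \<Rightarrow>
   ('x, 'z, 'y) sample \<Rightarrow> real^'x \<Rightarrow> real^'z \<Rightarrow> real \<Rightarrow> (real^'y) measure set" where
  "ambiguity_set p YY fhat n d x z \<xi> =
     {Q \<in> prob_on YY. wasserstein p Q (P_ER YY fhat n d x z) \<le> ennreal \<xi>}"

definition d3ro_objective ::
  "real \<Rightarrow> (real^'y) set \<Rightarrow> (real^'z \<Rightarrow> real^'y \<Rightarrow> real) \<Rightarrow>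
   (('x, 'z, 'y) sample \<Rightarrow> real^'x \<Rightarrow> real^'z \<Rightarrow> real^'y) \<Rightarrow> nat \<Rightarrow>
   ('x, 'z, 'y) sample \<Rightarrow> real \<Rightarrow> real^'x \<Rightarrow> real^'z \<Rightarrow> ereal" where
  "d3ro_objective p YY c fhat n d \<xi> x z =
     (SUP Q\<in>ambiguity_set p YY fhat n d x z \<xi>. ext_expectation Q (c z))"

definition d3ro_value ::
  "real \<Rightarrow> (real^'z) set \<Rightarrow> (real^'y) set \<Rightarrow> (real^'z \<Rightarrow> real^'y \<Rightarrow> real) \<Rightarrow>
   (('x, 'z, 'y) sample \<Rightarrow> real^'x \<Rightarrow> real^'z \<Rightarrow> real^'y) \<Rightarrow> nat \<Rightarrow>
   ('x, 'z, 'y) sample \<Rightarrow> real \<Rightarrow> real^'x \<Rightarrow> ereal" where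
  "d3ro_value p ZZ YY c fhat n d \<xi> x = (INF z\<in>ZZ. d3ro_objective p YY c fhat n d \<xi> x z)"

text \<open>The infinite values in \<open>ereal\<close> are allowed here; that \<open>f\<close> is finite is a separate matter.
  At an isolated point of \<open>A\<close> the limes inferior is \<open>\<infinity>\<close> and the condition is void.\<close>

definition lsc_on :: "'a::topological_space set \<Rightarrow> ('a \<Rightarrow> ereal) \<Rightarrow> bool" where
  "lsc_on A f \<longleftrightarrow> (\<forall>z\<in>A. f z \<le> Liminf (at z within A) f)"

text \<open>The law of \<open>Y(x, z) = f\<^sup>*(x, z) + \<epsilon>\<close>, i.e. the conditional law of \<open>Y\<close> given
  \<open>X = x, Z = z\<close>.\<close>

definition cond_law ::
  "'s measure \<Rightarrow> ('s \<Rightarrow> real^'y) \<Rightarrow> (real^'x \<Rightarrow> real^'z \<Rightarrow> real^'y) \<Rightarrow>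
   real^'x \<Rightarrow> real^'z \<Rightarrow> (real^'y) measure" where
  "cond_law S eps fstar x z = distr S borel (\<lambda>s. fstar x z + eps s)"

definition true_cost ::
  "'s measure \<Rightarrow> ('s \<Rightarrow> real^'y) \<Rightarrow> (real^'x \<Rightarrow> real^'z \<Rightarrow> real^'y) \<Rightarrow>
   (real^'z \<Rightarrow> real^'y \<Rightarrow> real) \<Rightarrow> real^'z \<Rightarrow> real^'x \<Rightarrow> real" where
  "true_cost S eps fstar c z x = (\<integral>s. c z (fstar x z + eps s) \<partial>S)"

text \<open>Decisions in \<open>ZZ\<close> that may depend measurably on the sample; a fixed decision \<open>z \<in> ZZ\<close> is
  the constant rule.  Error bounds at every fixed \<open>z\<close> say nothing about the error at a
  minimiser computed from the sample, hence this class.\<close>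

definition data_driven_decisions ::
  "nat \<Rightarrow> (real^'z) set \<Rightarrow> (('x::finite, 'z::finite, 'y::finite) sample \<Rightarrow> real^'z) set" where
  "data_driven_decisions n ZZ =
     {\<zeta> \<in> measurable (sample_space n) borel. \<forall>d\<in>space (sample_space n). \<zeta> d \<in> ZZ}"

text \<open>\<open>S\<close> carries \<open>(X, Z, Y, \<epsilon>)\<close>, \<open>M\<close> carries the data; they may coincide.
  The assumptions \<open>model\<close>, \<open>eps_mean\<close> and \<open>eps_indep\<close> make \<open>f\<^sup>*(X, Z)\<close> a version of
  \<open>E[Y | X, Z]\<close>.  Supports are only determined by the marginal laws, so that
  \<open>f\<^sup>*(x, z) + \<epsilon>\<close> lies in \<open>YY\<close> for \<^emph>\<open>all\<close> \<open>x \<in> XX\<close>, \<open>z \<in> ZZ\<close> has to be said (\<open>cond_law_on\<close>).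
  No joint law of the observations is prescribed.\<close>

locale regression_model =
  S: prob_space S + M: prob_space M
  for S :: "'s measure" and M :: "'w measure" +
  fixes X :: "'s \<Rightarrow> real^'x" and Z :: "'s \<Rightarrow> real^'z" and Y eps :: "'s \<Rightarrow> real^'y"
    and fstar :: "real^'x \<Rightarrow> real^'z \<Rightarrow> real^'y"
    and XX :: "(real^'x) set" and ZZ :: "(real^'z) set" and YY :: "(real^'y) set"
    and D :: "nat \<Rightarrow> 'w \<Rightarrow> ('x, 'z, 'y) obs"
  assumes X_rv: "X \<in> borel_measurable S"
    and Z_rv: "Z \<in> borel_measurable S"
    and Y_rv: "Y \<in> borel_measurable S"
    and eps_rv: "eps \<in> borel_measurable S"
    and XX: "XX = rv_support S X"
    and ZZ: "ZZ = rv_support S Z" "ZZ \<noteq> {}" "compact ZZ"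
    and YY: "YY = rv_support S Y" "YY \<noteq> {}" "closed YY" "convex YY"
    and fstar_meas: "(\<lambda>(x, z). fstar x z) \<in> borel_measurable borel"
    and model: "AE s in S. Y s = fstar (X s) (Z s) + eps s"
    and eps_mean: "integrable S eps" "(\<integral>s. eps s \<partial>S) = 0"
    and eps_indep: "S.indep_set (sets (vimage_algebra (space S) (\<lambda>s. (X s, Z s)) borel))
                              (sets (vimage_algebra (space S) eps borel))"
    and cond_law_on: "\<And>x z. x \<in> XX \<Longrightarrow> z \<in> ZZ \<Longrightarrow> AE s in S. fstar x z + eps s \<in> YY"
    and data_rv: "\<And>k. 1 \<le> k \<Longrightarrow> D k \<in> borel_measurable M"
    and data_range: "\<And>k. 1 \<le> k \<Longrightarrow> AE \<omega> in M. D k \<omega> \<in> XX \<times> ZZ \<times> YY"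

end

theory Submission
  imports Defs
begin

text \<open>
  If the radius-\<open>\<xi>\<close> Wasserstein ball around the estimated empirical law contains the true
  conditional law at the decision \<open>zhat\<close>, the robust objective there dominates the true cost.
  The distance splits into the error of \<open>fhat\<close> at \<open>(x, zhat)\<close>, the mean in-sample error and the
  distance of \<open>P_star\<close> to the conditional law; projecting onto \<open>YY\<close> does not increase it, because
  the projection is a contraction that fixes the conditional law.  Changing \<open>z\<close> translates
  \<open>P_star\<close> and the conditional law by the same vector, so the concentration bound at one fixed \<open>z\<close>
  also applies at the data-dependent \<open>zhat\<close>.  A union bound over the three errors, with
  probabilities \<open>\<alpha>/4\<close>, \<open>\<alpha>/4\<close> and \<open>\<alpha>/2\<close>, finishes the argument.
\<close>

section \<open>Averages over indices and the convexity of powers\<close>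

lemma nn_integral_uniform_count_measure:
  "finite A \<Longrightarrow> (\<integral>\<^sup>+k. f k \<partial>uniform_count_measure A) = (\<Sum>k\<in>A. ennreal (1 / card A) * f k)"
  by (simp add: uniform_count_measure_def nn_integral_point_measure_finite mult.commute)

text \<open>Convexity of \<open>x powr p\<close> at weights proportional to \<open>s\<close> and \<open>t\<close>; when \<open>s\<close> and \<open>t\<close> bound the
  \<open>L\<^sup>p\<close> norms of \<open>u\<close> and \<open>v\<close>, integrating it replaces Minkowski's inequality.\<close>

lemma powr_add_le:
  fixes u v s t p :: real
  assumes p: "1 \<le> p" and uv: "0 \<le> u" "0 \<le> v" and st: "0 < s" "0 < t"
  shows "(u + v) powr p \<le>
    (s + t) powr p * (s / (s + t) * (u / s) powr p + t / (s + t) * (v / t) powr p)"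
proof -
  have one: "x powr p \<le> x" if "0 \<le> x" "x \<le> 1" for x :: real
    using powr_mono'[of 1 p x] that p by simp
  \<comment> \<open>With one summand zero the claim reduces to \<open>l powr p \<le> l\<close> for a
    weight \<open>l\<close> in the unit interval; convexity is then applied at positive arguments
    only.\<close>
  have zero: "v powr p \<le> (s + t) powr p * (t / (s + t) * (v / t) powr p)"
    if "0 \<le> v" "0 < s" "0 < t" for v s t :: real
  proof -
    have "v powr p = (s + t) powr p * ((t / (s + t)) powr p * (v / t) powr p)"
      using that by (simp flip: powr_mult)
    also have "\<dots> \<le> (s + t) powr p * (t / (s + t) * (v / t) powr p)"
      using that by (intro mult_left_mono mult_right_mono one) auto
    finally show ?thesis .
  qed
  consider "u = 0" | "v = 0" | "0 < u" "0 < v" using uv by linarith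
  then show ?thesis
  proof cases
    case 1
    then show ?thesis using zero[of v s t] uv st by simp
  next
    case 2
    then show ?thesis using zero[of u t s] uv st by (simp add: add.commute)
  next
    case 3
    define l where "l = t / (s + t)"
    have l: "0 \<le> l" "l \<le> 1" "1 - l = s / (s + t)" using st by (auto simp: l_def field_simps)
    have "((1 - l) *\<^sub>R (u / s) + l *\<^sub>R (v / t)) powr p
        \<le> (1 - l) * (u / s) powr p + l * (v / t) powr p"
      using powr_convex[OF p] by (rule convex_onD) (use 3 st l in auto)
    moreover have "(1 - l) *\<^sub>R (u / s) + l *\<^sub>R (v / t) = (u + v) / (s + t)"
      unfolding l(3) using st by (simp add: l_def add_divide_distrib)
    ultimately have "((u + v) / (s + t)) powr p \<le> s / (s + t) * (u / s) powr p + t / (s + t) * (v / t) powr p"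
      by (simp only: l(3) flip: l_def)
    then have "(s + t) powr p * ((u + v) / (s + t)) powr p \<le> (s + t) powr p * (s / (s + t) * (u / s) powr p + t / (s + t) * (v / t) powr p)"
      by (intro mult_left_mono) auto
    then show ?thesis using uv st by (simp flip: powr_mult)
  qed
qed

section \<open>The extended root and the Wasserstein distance\<close>

lemma ennreal_root_mono: "0 < p \<Longrightarrow> s \<le> t \<Longrightarrow> ennreal_root p s \<le> ennreal_root p t"
  by (auto simp: ennreal_root_def top_unique less_top enn2real_mono intro!: ennreal_leI powr_mono2)

text \<open>Transfers bounds on distances to bounds on transport costs; at an infinite cost both
  sides fail.\<close>

lemma ennreal_root_le_iff:
  assumes "0 < p" "0 \<le> r"
  shows "ennreal_root p t \<le> ennreal r \<longleftrightarrow> t \<le> ennreal (r powr p)"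
proof (cases t)
  case (real u)
  have "u powr (1 / p) \<le> r \<longleftrightarrow> u \<le> r powr p"
  proof
    assume "u powr (1 / p) \<le> r"
    then have "(u powr (1 / p)) powr p \<le> r powr p" using assms by (intro powr_mono2) auto
    then show "u \<le> r powr p" using assms real by (simp add: powr_powr)
  next
    assume "u \<le> r powr p"
    then have "u powr (1 / p) \<le> (r powr p) powr (1 / p)" using assms real by (intro powr_mono2) auto
    then show "u powr (1 / p) \<le> r" using assms by (simp add: powr_powr)
  qed
  then show ?thesis using real assms by (simp add: ennreal_root_def)
qed (auto simp: ennreal_root_def top_unique)

lemma ennreal_root_less_iff:
  assumes "0 < p" "0 \<le> r"
  shows "ennreal_root p t < ennreal r \<longleftrightarrow> t < ennreal (r powr p)"
proof (cases t)
  case (real u)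
  have "u powr (1 / p) < r \<longleftrightarrow> u < r powr p"
  proof
    assume "u powr (1 / p) < r"
    then have "(u powr (1 / p)) powr p < r powr p" using assms by (intro powr_less_mono2) auto
    then show "u < r powr p" using assms real by (simp add: powr_powr)
  next
    assume "u < r powr p"
    then have "u powr (1 / p) < (r powr p) powr (1 / p)" using assms real by (intro powr_less_mono2) auto
    then show "u powr (1 / p) < r" using assms by (simp add: powr_powr)
  qed
  then show ?thesis using real assms by (simp add: ennreal_root_def ennreal_less_iff)
qed (auto simp: ennreal_root_def top_unique)

lemma wasserstein_le:
  assumes "\<pi> \<in> couplings \<mu> \<nu>" "0 < p" "0 \<le> r"
    and "(\<integral>\<^sup>+(y1, y2). ennreal (norm (y1 - y2) powr p) \<partial>\<pi>) \<le> ennreal (r powr p)"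
  shows "wasserstein p \<mu> \<nu> \<le> ennreal r"
  unfolding wasserstein_def ennreal_root_le_iff[OF assms(2,3)]
  using assms(1,4) by (rule INF_lower2)

text \<open>A strict bound on an infimum is witnessed by some coupling, whereas a weak bound would
  require an optimal one. This is why strict inequalities are carried along below.\<close>

lemma wasserstein_lessE:
  assumes "wasserstein p \<mu> \<nu> < ennreal r" "0 < p" "0 \<le> r"
  obtains \<pi> where "\<pi> \<in> couplings \<mu> \<nu>"
    "(\<integral>\<^sup>+(y1, y2). ennreal (norm (y1 - y2) powr p) \<partial>\<pi>) < ennreal (r powr p)"
  using assms unfolding wasserstein_def ennreal_root_less_iff[OF assms(2,3)] INF_less_iff by blast

text \<open>The image of a coupling under \<open>f\<close> in both coordinates couples the image
  measures, at no greater cost. Applied to the projection onto \<open>YY\<close> and to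
  translations.\<close>

lemma wasserstein_distr_le:
  fixes f :: "'a::euclidean_space \<Rightarrow> 'a"
  assumes f: "\<And>y1 y2. norm (f y1 - f y2) \<le> norm (y1 - y2)" and p: "0 < p"
  shows "wasserstein p (distr \<mu> borel f) (distr \<nu> borel f) \<le> wasserstein p \<mu> \<nu>"
proof -
  have "1-lipschitz_on UNIV f" using f by (intro lipschitz_onI) (auto simp: dist_norm)
  then have fm[measurable]: "f \<in> borel_measurable borel"
    by (intro borel_measurable_continuous_onI lipschitz_on_continuous_on)
  have "(INF \<pi>\<in>couplings (distr \<mu> borel f) (distr \<nu> borel f).
      \<integral>\<^sup>+(y1, y2). ennreal (norm (y1 - y2) powr p) \<partial>\<pi>)
    \<le> (INF \<pi>\<in>couplings \<mu> \<nu>. \<integral>\<^sup>+(y1, y2). ennreal (norm (y1 - y2) powr p) \<partial>\<pi>)"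
  proof (rule INF_mono)
    fix \<pi> assume \<pi>: "\<pi> \<in> couplings \<mu> \<nu>"
    then have [measurable_cong]: "sets \<pi> = sets (borel \<Otimes>\<^sub>M borel)"
      and "prob_space \<pi>" and marg: "distr \<pi> borel fst = \<mu>" "distr \<pi> borel snd = \<nu>"
      by (auto simp: couplings_def)
    interpret prob_space \<pi> by fact
    let ?\<pi> = "distr \<pi> (borel \<Otimes>\<^sub>M borel) (\<lambda>w. (f (fst w), f (snd w)))"
    have "?\<pi> \<in> couplings (distr \<mu> borel f) (distr \<nu> borel f)"
      unfolding couplings_def marg[symmetric]
      by (auto intro!: prob_space_distr simp: distr_distr comp_def)
    moreover have "(\<integral>\<^sup>+(y1, y2). ennreal (norm (y1 - y2) powr p) \<partial>?\<pi>)
        \<le> (\<integral>\<^sup>+(y1, y2). ennreal (norm (y1 - y2) powr p) \<partial>\<pi>)"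
      using f p by (subst nn_integral_distr)
        (auto intro!: nn_integral_mono ennreal_leI powr_mono2 simp: case_prod_beta)
    ultimately show "\<exists>\<rho>\<in>couplings (distr \<mu> borel f) (distr \<nu> borel f).
      (\<integral>\<^sup>+(y1, y2). ennreal (norm (y1 - y2) powr p) \<partial>\<rho>)
        \<le> (\<integral>\<^sup>+(y1, y2). ennreal (norm (y1 - y2) powr p) \<partial>\<pi>)" by blast
  qed
  then show ?thesis unfolding wasserstein_def by (rule ennreal_root_mono[OF p])
qed

section \<open>Empirical measures and their couplings\<close>

lemma measurable_uniform_count_measure [measurable]: "f \<in> uniform_count_measure A \<rightarrow>\<^sub>M borel"
  by (auto simp: measurable_def space_uniform_count_measure sets_uniform_count_measure)

lemma distr_empirical:
  assumes [measurable]: "f \<in> borel_measurable borel"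
  shows "distr (empirical n y) borel f = empirical n (\<lambda>k. f (y k))"
  unfolding empirical_def by (subst distr_distr) (auto simp: comp_def)

text \<open>Atoms \<open>b j\<close> may coincide, so a coupling does not determine the index: \<open>\<gamma>\<close> chooses it uniformly
  among the indices of the atom.\<close>

lemma empirical_coupling_index:
  fixes b :: "nat \<Rightarrow> 'a::euclidean_space"
  assumes n: "1 \<le> n" and \<pi>: "\<pi> \<in> couplings (empirical n b) \<nu>"
  obtains \<gamma> where "sets \<gamma> = sets (uniform_count_measure {1..n} \<Otimes>\<^sub>M (borel \<Otimes>\<^sub>M borel))"
    "distr \<gamma> (uniform_count_measure {1..n}) fst = uniform_count_measure {1..n}"
    "distr \<gamma> (borel \<Otimes>\<^sub>M borel) snd = \<pi>"
    "AE w in \<gamma>. b (fst w) = fst (snd w)"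
proof -
  define U where "U = uniform_count_measure {1..n}"
  interpret U: prob_space U
    unfolding U_def using n by (intro prob_space_uniform_count_measure) auto
  have [measurable_cong]: "sets U = sets (count_space {1..n})"
    by (simp add: U_def sets_uniform_count_measure)
  have [measurable_cong]: "sets \<pi> = sets (borel \<Otimes>\<^sub>M borel)" and "prob_space \<pi>"
    and marg: "distr \<pi> borel fst = empirical n b"
    using \<pi> by (auto simp: couplings_def)
  interpret \<pi>: prob_space \<pi> by fact
  interpret P: pair_sigma_finite U \<pi> ..
  \<comment> \<open>The multiplicity of \<open>v\<close> among the atoms.\<close>
  define N where "N v = (\<Sum>j=1..n. indicator {b j} v :: real)" for v
  have [measurable]: "N \<in> borel_measurable borel" unfolding N_def by measurable
  \<comment> \<open>Density of \<open>\<gamma>\<close> with respect to the product of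
    \<open>U\<close> and \<open>\<pi>\<close>. The factor \<open>n\<close> cancels the weight
    \<open>1 / n\<close> of each index under \<open>U\<close>, so the mass at an atom is shared
    equally among the indices carrying it.\<close>
  define g where "g w = ennreal (real n * indicator {b (fst w)} (fst (snd w)) / N (fst (snd w)))"
    for w :: "nat \<times> 'a \<times> 'a"
  have g[measurable]: "g \<in> borel_measurable (U \<Otimes>\<^sub>M \<pi>)"
  proof -
    have "g \<in> borel_measurable (count_space {1..n} \<Otimes>\<^sub>M \<pi>)"
      by (intro measurable_pair_measure_countable1) (auto simp: g_def)
    also have "\<dots> = borel_measurable (U \<Otimes>\<^sub>M \<pi>)"
      by (intro measurable_cong_sets sets_pair_measure_cong) (auto simp: U_def sets_uniform_count_measure)
    finally show ?thesis .
  qed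
  define \<gamma> where "\<gamma> = density (U \<Otimes>\<^sub>M \<pi>) g"
  have Npos: "1 \<le> N (b k)" if "k \<in> {1..n}" for k
    unfolding N_def using member_le_sum[of k "{1..n}" "\<lambda>j. indicator {b j} (b k) :: real"] that by auto
  have b_img: "b ` {1..n} \<in> sets borel"
    by (intro borel_closed finite_imp_closed) auto
  have AEb: "AE w in \<pi>. fst w \<in> b ` {1..n}"
  proof -
    have "AE v in empirical n b. v \<in> b ` {1..n}"
      unfolding empirical_def
      by (subst AE_distr_iff) (use b_img in \<open>auto simp: space_uniform_count_measure\<close>)
    then show ?thesis unfolding marg[symmetric]
      by (subst (asm) AE_distr_iff) (use b_img in auto)
  qed
  have int: "(\<integral>\<^sup>+w. F w \<partial>\<gamma>) = (\<integral>\<^sup>+w. (\<Sum>k=1..n. ennreal (indicator {b k} (fst w) / N (fst w)) * F (k, w)) \<partial>\<pi>)"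
    if [measurable]: "F \<in> borel_measurable (U \<Otimes>\<^sub>M \<pi>)" for F
  proof -
    have "(\<integral>\<^sup>+w. F w \<partial>\<gamma>) = (\<integral>\<^sup>+w. (\<integral>\<^sup>+k. g (k, w) * F (k, w) \<partial>U) \<partial>\<pi>)"
      unfolding \<gamma>_def by (subst nn_integral_density) (auto simp: P.nn_integral_snd[of "\<lambda>w. g w * F w"])
    also have "\<dots> = (\<integral>\<^sup>+w. (\<Sum>k=1..n. ennreal (indicator {b k} (fst w) / N (fst w)) * F (k, w)) \<partial>\<pi>)"
      using n by (intro nn_integral_cong) (auto simp: U_def nn_integral_uniform_count_measure g_def
          simp flip: mult.assoc ennreal_mult' intro!: sum.cong)
    finally show ?thesis .
  qed
  have "distr \<gamma> (borel \<Otimes>\<^sub>M borel) snd = \<pi>"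
  proof (rule measure_eqI)
    fix A assume "A \<in> sets (distr \<gamma> (borel \<Otimes>\<^sub>M borel) snd)"
    then have [measurable]: "A \<in> sets (borel \<Otimes>\<^sub>M borel)" by simp
    have "emeasure (distr \<gamma> (borel \<Otimes>\<^sub>M borel) snd) A = (\<integral>\<^sup>+w. indicator A w \<partial>distr \<gamma> (borel \<Otimes>\<^sub>M borel) snd)"
      by simp
    also have "\<dots> = (\<integral>\<^sup>+w. indicator A (snd w) \<partial>\<gamma>)"
      by (subst nn_integral_distr) (auto simp: \<gamma>_def)
    also have "\<dots> = (\<integral>\<^sup>+w. (\<Sum>k=1..n. ennreal (indicator {b k} (fst w) / N (fst w)) * indicator A w) \<partial>\<pi>)"
      by (subst int) auto
    \<comment> \<open>On the atoms the weights add up to one; off the atoms they vanish, but that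
      set is null because the first marginal of \<open>\<pi>\<close> is
      \<open>empirical n b\<close>.\<close>
    also have "\<dots> = (\<integral>\<^sup>+w. indicator A w \<partial>\<pi>)"
    proof (intro nn_integral_cong_AE, use AEb in eventually_elim)
      fix w :: "'a \<times> 'a" assume "fst w \<in> b ` {1..n}"
      then have "1 \<le> N (fst w)" using Npos by auto
      then have "(\<Sum>k=1..n. indicator {b k} (fst w) / N (fst w)) = 1"
        by (simp add: N_def flip: sum_divide_distrib)
      then have "(\<Sum>k=1..n. ennreal (indicator {b k} (fst w) / N (fst w))) = 1"
        using \<open>1 \<le> N (fst w)\<close> by (subst sum_ennreal) auto
      then show "(\<Sum>k=1..n. ennreal (indicator {b k} (fst w) / N (fst w)) * indicator A w) = indicator A w"
        by (simp flip: sum_distrib_right)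
    qed
    finally show "emeasure (distr \<gamma> (borel \<Otimes>\<^sub>M borel) snd) A = emeasure \<pi> A" by simp
  qed (simp add: \<open>sets \<pi> = _\<close>)
  moreover have "distr \<gamma> U fst = U"
  proof (rule measure_eqI_finite)
    fix k assume k: "k \<in> {1..n}"
    have [measurable]: "{k} \<in> sets U" using k by (simp add: U_def sets_uniform_count_measure)
    have "emeasure (distr \<gamma> U fst) {k} = (\<integral>\<^sup>+w. indicator {k} w \<partial>distr \<gamma> U fst)"
      by simp
    also have "\<dots> = (\<integral>\<^sup>+w. indicator {k} (fst w) \<partial>\<gamma>)"
      by (subst nn_integral_distr) (auto simp: \<gamma>_def)
    also have "\<dots> = (\<integral>\<^sup>+w. (\<Sum>j=1..n. ennreal (indicator {b j} (fst w) / N (fst w)) * indicator {k} j) \<partial>\<pi>)"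
      by (subst int) auto
    also have "\<dots> = (\<integral>\<^sup>+w. ennreal (indicator {b k} (fst w) / N (fst w)) \<partial>\<pi>)"
      using k by (intro nn_integral_cong) (simp add: indicator_def if_distrib sum.delta cong: if_cong)
    also have "\<dots> = (\<integral>\<^sup>+v. ennreal (indicator {b k} v / N v) \<partial>empirical n b)"
      unfolding marg[symmetric] by (subst nn_integral_distr) auto
    also have "\<dots> = (\<Sum>j=1..n. ennreal (1 / n) * ennreal (indicator {b k} (b j) / N (b j)))"
      unfolding empirical_def by (subst nn_integral_distr) (auto simp: nn_integral_uniform_count_measure)
    \<comment> \<open>Where the indicator is nonzero, \<open>b j = b k\<close> and hence
      \<open>N (b j) = N (b k)\<close>; the sum over \<open>j\<close> then counts exactly
      \<open>N (b k)\<close> indices.\<close>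
    also have "\<dots> = (\<Sum>j=1..n. ennreal (1 / n * (indicator {b j} (b k) / N (b k))))"
      by (intro sum.cong) (auto simp: indicator_def simp flip: ennreal_mult')
    also have "\<dots> = ennreal (1 / n * (N (b k) / N (b k)))"
    proof -
      have "(\<Sum>j=1..n. 1 / n * (indicator {b j} (b k) / N (b k))) = 1 / n * (N (b k) / N (b k))"
        by (subst (2) N_def) (simp only: sum_divide_distrib sum_distrib_left)
      then show ?thesis using Npos[OF k] by (subst sum_ennreal) auto
    qed
    also have "\<dots> = emeasure U {k}"
      using Npos[OF k] k n by (simp add: U_def emeasure_uniform_count_measure)
    finally show "emeasure (distr \<gamma> U fst) {k} = emeasure U {k}" .
  qed (auto simp: U_def sets_uniform_count_measure)
  moreover have "AE w in \<gamma>. b (fst w) = fst (snd w)"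
    unfolding \<gamma>_def by (subst AE_density) (auto simp: g_def indicator_def)
  moreover have "sets \<gamma> = sets (U \<Otimes>\<^sub>M (borel \<Otimes>\<^sub>M borel))"
    unfolding \<gamma>_def sets_density by (intro sets_pair_measure_cong refl) fact
  ultimately show thesis using that unfolding U_def by blast
qed

text \<open>Triangle inequality through \<open>empirical n b\<close>, carried out by gluing: the
  index drawn under \<open>\<gamma>\<close> links \<open>a k\<close> to \<open>b k\<close>, and the
  pair links \<open>b k\<close> to a point of law \<open>\<nu>\<close>. The conclusion exchanges the
  arguments because the ambiguity set puts the candidate law first.\<close>

lemma wasserstein_empirical_perturb:
  fixes a b :: "nat \<Rightarrow> 'a::euclidean_space"
  assumes n: "1 \<le> n" and p: "1 \<le> p" and s: "0 < s" and r: "0 < r"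
    and W: "wasserstein p (empirical n b) \<nu> < ennreal r"
    and ab: "(1 / real n) * (\<Sum>k=1..n. norm (a k - b k) powr p) \<le> s powr p"
  shows "wasserstein p \<nu> (empirical n a) \<le> ennreal (s + r)"
proof -
  let ?U = "uniform_count_measure {1..n}"
  have p0: "0 < p" using p by simp
  obtain \<pi> where \<pi>: "\<pi> \<in> couplings (empirical n b) \<nu>"
    and cost: "(\<integral>\<^sup>+(y1, y2). ennreal (norm (y1 - y2) powr p) \<partial>\<pi>) < ennreal (r powr p)"
    using wasserstein_lessE[OF W p0] r by (metis less_imp_le)
  obtain \<gamma> where sets_\<gamma>[measurable_cong]: "sets \<gamma> = sets (?U \<Otimes>\<^sub>M (borel \<Otimes>\<^sub>M borel))"
    and fst_\<gamma>: "distr \<gamma> ?U fst = ?U"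
    and snd_\<gamma>: "distr \<gamma> (borel \<Otimes>\<^sub>M borel) snd = \<pi>"
    and b: "AE w in \<gamma>. b (fst w) = fst (snd w)"
    using empirical_coupling_index[OF n \<pi>] by blast
  have "prob_space ?U" using n by (intro prob_space_uniform_count_measure) auto
  moreover have fst_meas: "fst \<in> \<gamma> \<rightarrow>\<^sub>M ?U" by measurable
  ultimately interpret prob_space \<gamma> using prob_space_distrD fst_\<gamma> by metis
  have a_fst[measurable]: "(\<lambda>w. a (fst w)) \<in> borel_measurable \<gamma>"
    "(\<lambda>w. b (fst w)) \<in> borel_measurable \<gamma>"
    by (auto intro!: measurable_compose[OF _ measurable_uniform_count_measure, of fst])
  \<comment> \<open>The second point of the pair against the atom \<open>a k\<close> of the drawn
    index. Almost everywhere the first point is \<open>b k\<close>, and the displacement is split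
    there.\<close>
  let ?\<rho> = "distr \<gamma> (borel \<Otimes>\<^sub>M borel) (\<lambda>w. (snd (snd w), a (fst w)))"
  have "distr ?\<rho> borel snd = distr (distr \<gamma> ?U fst) borel a"
    by (subst distr_distr[OF measurable_uniform_count_measure fst_meas], subst distr_distr)
      (auto simp: comp_def)
  moreover have "distr ?\<rho> borel fst = distr (distr \<gamma> (borel \<Otimes>\<^sub>M borel) snd) borel snd"
    by (simp add: distr_distr comp_def)
  ultimately have "?\<rho> \<in> couplings \<nu> (empirical n a)"
    using \<pi> unfolding fst_\<gamma> snd_\<gamma> couplings_def empirical_def by (auto intro!: prob_space_distr)
  moreover have "(\<integral>\<^sup>+(y1, y2). ennreal (norm (y1 - y2) powr p) \<partial>?\<rho>) \<le> ennreal ((s + r) powr p)"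
  proof -
    \<comment> \<open>\<open>C\<close> and \<open>C'\<close> are the coefficients of
      \<open>u powr p\<close> and \<open>v powr p\<close> in \<open>powr_add_le\<close>. Inserting
      the bounds \<open>s powr p\<close> and \<open>r powr p\<close> for the two integrals gives
      exactly \<open>(s + r) powr p\<close>.\<close>
    define C where "C = (s + r) powr p * (s / (s + r) / s powr p)"
    define C' where "C' = (s + r) powr p * (r / (s + r) / r powr p)"
    have C: "0 \<le> C" "0 \<le> C'" using s r by (auto simp: C_def C'_def)
    have "(\<integral>\<^sup>+(y1, y2). ennreal (norm (y1 - y2) powr p) \<partial>?\<rho>)
        = (\<integral>\<^sup>+w. ennreal (norm (snd (snd w) - a (fst w)) powr p) \<partial>\<gamma>)"
      by (subst nn_integral_distr) (auto simp: case_prod_beta)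
    also have "\<dots> \<le> (\<integral>\<^sup>+w. ennreal C * ennreal (norm (a (fst w) - b (fst w)) powr p)
        + ennreal C' * ennreal (norm (fst (snd w) - snd (snd w)) powr p) \<partial>\<gamma>)"
    proof (intro nn_integral_mono_AE, use b in eventually_elim)
      fix w :: "nat \<times> 'a \<times> 'a" assume b: "b (fst w) = fst (snd w)"
      define u v where "u = norm (a (fst w) - b (fst w))" and "v = norm (fst (snd w) - snd (snd w))"
      have "snd (snd w) - a (fst w) = - ((a (fst w) - b (fst w)) + (fst (snd w) - snd (snd w)))"
        using b by simp
      then have "norm (snd (snd w) - a (fst w)) \<le> u + v"
        unfolding u_def v_def by (simp only: norm_minus_cancel norm_triangle_ineq)
      then have "norm (snd (snd w) - a (fst w)) powr p \<le> (u + v) powr p"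
        using p by (intro powr_mono2) auto
      also have "\<dots> \<le> C * u powr p + C' * v powr p"
        using powr_add_le[OF p _ _ s r, of u v] s r
        by (simp add: u_def v_def C_def C'_def powr_divide algebra_simps)
      finally have "ennreal (norm (snd (snd w) - a (fst w)) powr p) \<le> ennreal (C * u powr p + C' * v powr p)"
        by (rule ennreal_leI)
      then show "ennreal (norm (snd (snd w) - a (fst w)) powr p)
          \<le> ennreal C * ennreal (norm (a (fst w) - b (fst w)) powr p)
            + ennreal C' * ennreal (norm (fst (snd w) - snd (snd w)) powr p)"
        using C by (simp add: ennreal_mult u_def v_def)
    qed
    also have "\<dots> = ennreal C * (\<integral>\<^sup>+w. ennreal (norm (a (fst w) - b (fst w)) powr p) \<partial>\<gamma>)
        + ennreal C' * (\<integral>\<^sup>+w. ennreal (norm (fst (snd w) - snd (snd w)) powr p) \<partial>\<gamma>)"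
      by (simp add: nn_integral_add nn_integral_cmult)
    also have "(\<integral>\<^sup>+w. ennreal (norm (a (fst w) - b (fst w)) powr p) \<partial>\<gamma>)
        = (\<integral>\<^sup>+k. ennreal (norm (a k - b k) powr p) \<partial>distr \<gamma> ?U fst)"
      by (subst nn_integral_distr[OF fst_meas]) auto
    also have "\<dots> = ennreal ((1 / real n) * (\<Sum>k=1..n. norm (a k - b k) powr p))"
      unfolding fst_\<gamma> by (simp add: nn_integral_uniform_count_measure sum_distrib_left
          flip: ennreal_mult sum_ennreal)
    also have "\<dots> \<le> ennreal (s powr p)" by (rule ennreal_leI[OF ab])
    also have "(\<integral>\<^sup>+w. ennreal (norm (fst (snd w) - snd (snd w)) powr p) \<partial>\<gamma>)
        = (\<integral>\<^sup>+w. ennreal (norm (fst w - snd w) powr p) \<partial>distr \<gamma> (borel \<Otimes>\<^sub>M borel) snd)"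
      by (subst nn_integral_distr) auto
    also have "\<dots> \<le> ennreal (r powr p)"
      unfolding snd_\<gamma> using less_imp_le[OF cost] by (simp add: case_prod_unfold)
    also have "ennreal C * ennreal (s powr p) + ennreal C' * ennreal (r powr p)
        = ennreal (C * s powr p + C' * r powr p)"
      using C by (simp add: ennreal_mult)
    also have "C * s powr p + C' * r powr p = (s + r) powr p * (s / (s + r) + r / (s + r))"
      using s r by (simp add: C_def C'_def distrib_left)
    also have "\<dots> = (s + r) powr p"
      using s r by (simp flip: add_divide_distrib)
    finally show ?thesis by (simp add: add_mono mult_left_mono)
  qed
  ultimately show ?thesis using p s r by (intro wasserstein_le) auto
qed

text \<open>Minkowski's inequality for the uniform distribution on \<open>I\<close>, with
  \<open>s\<close> and \<open>t\<close> bounding the two norms: after summing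
  \<open>powr_add_le\<close> the weights recombine to one.\<close>

lemma sum_powr_add_le:
  fixes u v :: "'i \<Rightarrow> real"
  assumes p: "1 \<le> p" and fin: "finite I" "I \<noteq> {}"
    and u: "\<And>k. k \<in> I \<Longrightarrow> 0 \<le> u k" "(\<Sum>k\<in>I. u k powr p) \<le> card I * s powr p"
    and v: "\<And>k. k \<in> I \<Longrightarrow> 0 \<le> v k" "(\<Sum>k\<in>I. v k powr p) \<le> card I * t powr p"
    and st: "0 < s" "0 < t"
  shows "(\<Sum>k\<in>I. (u k + v k) powr p) \<le> card I * (s + t) powr p"
proof -
  define C where "C = (s + t) powr p * (s / (s + t) / s powr p)"
  define C' where "C' = (s + t) powr p * (t / (s + t) / t powr p)"
  have C: "0 \<le> C" "0 \<le> C'" using st by (auto simp: C_def C'_def)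
  have "(\<Sum>k\<in>I. (u k + v k) powr p) \<le> (\<Sum>k\<in>I. C * u k powr p + C' * v k powr p)"
  proof (rule sum_mono)
    fix k assume "k \<in> I"
    then show "(u k + v k) powr p \<le> C * u k powr p + C' * v k powr p"
      using powr_add_le[OF p u(1) v(1) st] u(1) v(1) st
      by (simp add: C_def C'_def powr_divide algebra_simps)
  qed
  also have "\<dots> = C * (\<Sum>k\<in>I. u k powr p) + C' * (\<Sum>k\<in>I. v k powr p)"
    by (simp add: sum.distrib sum_distrib_left)
  also have "\<dots> \<le> C * (card I * s powr p) + C' * (card I * t powr p)"
    by (intro add_mono mult_left_mono u v C)
  also have "\<dots> = card I * ((s + t) powr p * (s / (s + t) + t / (s + t)))"
  proof -
    have "C * s powr p = (s + t) powr p * (s / (s + t))"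
      "C' * t powr p = (s + t) powr p * (t / (s + t))"
      using st by (simp_all add: C_def C'_def)
    then show ?thesis unfolding distrib_left mult.left_commute[of _ "real (card I)"] by simp
  qed
  also have "\<dots> = card I * (s + t) powr p"
    using st by (simp flip: add_divide_distrib)
  finally show ?thesis .
qed

section \<open>Supports and extended expectations\<close>

text \<open>The complement of the support is the union of all open null sets, which is null because
  the Lindelof property reduces it to a countable union.\<close>

lemma AE_in_rv_support:
  fixes X :: "'s \<Rightarrow> 'a::second_countable_topology"
  assumes "prob_space S" and X: "X \<in> borel_measurable S"
  shows "AE x in distr S borel X. x \<in> rv_support S X"
proof -
  interpret D: prob_space "distr S borel X" using assms by (rule prob_space.prob_space_distr)
  define \<F> where "\<F> = {U. open U \<and> measure (distr S borel X) U = 0}"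
  obtain \<F>' where \<F>': "\<F>' \<subseteq> \<F>" "countable \<F>'" "\<Union>\<F>' = \<Union>\<F>"
    using Lindelof[of \<F>] by (auto simp: \<F>_def)
  have "(\<Union>U\<in>\<F>'. U) \<in> null_sets (distr S borel X)"
    using \<F>' by (intro null_sets_UN') (auto simp: \<F>_def null_sets_def D.emeasure_eq_measure)
  moreover have "{x \<in> space (distr S borel X). x \<notin> rv_support S X} \<subseteq> (\<Union>U\<in>\<F>'. U)"
    using \<F>'(3) by (auto simp: \<F>_def rv_support_def zero_less_measure_iff measure_le_0_iff)
  ultimately show ?thesis by (rule AE_I')
qed

lemma ext_expectation_eq:
  assumes "integrable Q h"
  shows "ext_expectation Q h = ereal (\<integral>y. h y \<partial>Q)"
proof -
  have "(\<integral>\<^sup>+y. ennreal (h y) \<partial>Q) < \<infinity>" "(\<integral>\<^sup>+y. ennreal (- h y) \<partial>Q) < \<infinity>"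
    using assms by (auto simp: real_integrable_def less_top)
  then show ?thesis
    unfolding ext_expectation_def real_lebesgue_integral_def[OF assms]
    by (cases "\<integral>\<^sup>+y. ennreal (h y) \<partial>Q"; cases "\<integral>\<^sup>+y. ennreal (- h y) \<partial>Q") auto
qed

section \<open>Distance between the conditional law and the projected empirical law\<close>

text \<open>Deterministic, for one sample \<open>d\<close>, so that \<open>z\<close> may later be
  the decision computed from that sample. The two regression errors displace the atoms by at most
  \<open>s + t\<close> in the mean of order \<open>p\<close>.\<close>

lemma wasserstein_P_ER:
  assumes n: "1 \<le> n" and p: "1 \<le> p" and pos: "0 < s" "0 < t" "0 < r"
    and YY: "closed YY" "convex YY" "YY \<noteq> {}"
    and \<nu>: "sets \<nu> = sets borel" "AE y in \<nu>. y \<in> YY"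
    and at_xz: "norm (fstar x z - fhat d x z) \<le> s"
    and in_sample: "(1 / real n) * (\<Sum>k=1..n. norm (fstar (obs_x (d k)) (obs_z (d k))
          - fhat d (obs_x (d k)) (obs_z (d k))) powr p) \<le> t powr p"
    and W: "wasserstein p (P_star fstar n d x z) \<nu> < ennreal r"
  shows "wasserstein p \<nu> (P_ER YY fhat n d x z) \<le> ennreal (s + t + r)"
proof -
  define a where "a k = fhat d x z + residual (fhat d) d k" for k
  define b where "b k = fstar x z + residual fstar d k" for k
  define v where "v k = norm (fstar (obs_x (d k)) (obs_z (d k)) - fhat d (obs_x (d k)) (obs_z (d k)))" for k
  \<comment> \<open>The observed response cancels, leaving the in-sample error at \<open>k\<close>
    minus the error at \<open>(x, z)\<close>.\<close>
  have "a k - b k = (fstar (obs_x (d k)) (obs_z (d k)) - fhat d (obs_x (d k)) (obs_z (d k)))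
      - (fstar x z - fhat d x z)" for k
    by (simp add: a_def b_def residual_def)
  then have "norm (a k - b k) \<le> s + v k" for k
    using at_xz norm_triangle_ineq4[of "fstar (obs_x (d k)) (obs_z (d k)) - fhat d (obs_x (d k)) (obs_z (d k))"
      "fstar x z - fhat d x z"] by (simp add: v_def)
  then have "(\<Sum>k=1..n. norm (a k - b k) powr p) \<le> (\<Sum>k=1..n. (s + v k) powr p)"
    using p by (intro sum_mono powr_mono2) auto
  also have "\<dots> \<le> card {1..n} * (s + t) powr p"
    using n pos in_sample by (intro sum_powr_add_le p) (auto simp: v_def field_simps)
  finally have "(1 / real n) * (\<Sum>k=1..n. norm (a k - b k) powr p) \<le> (s + t) powr p"
    using n by (simp add: field_simps)
  then have *: "wasserstein p \<nu> (empirical n a) \<le> ennreal (s + t + r)"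
    using n p pos W unfolding P_star_def b_def[symmetric]
    by (intro wasserstein_empirical_perturb) auto
  have [measurable]: "closest_point YY \<in> borel_measurable borel"
    by (intro borel_measurable_continuous_onI continuous_on_closest_point YY)
  \<comment> \<open>The projection is the identity on \<open>YY\<close>, which carries
    \<open>\<nu>\<close>; projecting both measures therefore changes only the empirical one.\<close>
  have "distr \<nu> borel (closest_point YY) = distr \<nu> borel (\<lambda>y. y)"
    using \<nu>(2) YY by (intro distr_cong_AE)
      (auto elim!: eventually_mono simp: closest_point_self measurable_cong_sets[OF \<nu>(1) refl])
  also have "\<dots> = \<nu>" using \<nu>(1) by (intro distr_id2) simp
  finally have "wasserstein p \<nu> (P_ER YY fhat n d x z)
      = wasserstein p (distr \<nu> borel (closest_point YY)) (distr (empirical n a) borel (closest_point YY))"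
    by (simp add: P_ER_def distr_empirical a_def)
  also have "\<dots> \<le> wasserstein p \<nu> (empirical n a)"
    using p closest_point_lipschitz[OF YY(2,1,3)] by (intro wasserstein_distr_le) (auto simp: dist_norm)
  finally show ?thesis using * by simp
qed

text \<open>Neither the residuals of \<open>fstar\<close> nor \<open>eps\<close> depend on the
  point, so passing from \<open>(x', z')\<close> to \<open>(x, z)\<close> is one common translation.
  Exchanging the two points gives the reverse inequality.\<close>

lemma wasserstein_P_star_translate:
  assumes "0 < p" "eps \<in> borel_measurable S"
  shows "wasserstein p (P_star fstar n d x z) (cond_law S eps fstar x z)
    \<le> wasserstein p (P_star fstar n d x' z') (cond_law S eps fstar x' z')"
proof -
  let ?T = "\<lambda>y. y + (fstar x z - fstar x' z')"
  have "P_star fstar n d x z = distr (P_star fstar n d x' z') borel ?T"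
    unfolding P_star_def by (subst distr_empirical) (auto simp: algebra_simps)
  moreover have "cond_law S eps fstar x z = distr (cond_law S eps fstar x' z') borel ?T"
    unfolding cond_law_def using assms(2) by (subst distr_distr) (auto simp: comp_def algebra_simps)
  ultimately show ?thesis using assms(1) by (auto intro!: wasserstein_distr_le)
qed

section \<open>From the conditional law to the robust objective\<close>

lemma sets_cond_law [simp]: "sets (cond_law S eps fstar x z) = sets borel"
  by (simp add: cond_law_def)

lemma AE_cond_law_iff:
  assumes [measurable]: "eps \<in> borel_measurable S" "A \<in> sets borel"
  shows "(AE y in cond_law S eps fstar x z. y \<in> A) \<longleftrightarrow> (AE s in S. fstar x z + eps s \<in> A)"
  unfolding cond_law_def by (subst AE_distr_iff) auto

lemma d3ro_value_eq:
  assumes "is_arg_min (d3ro_objective p YY c fhat n d \<xi> x) (\<lambda>z. z \<in> ZZ) z"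
  shows "d3ro_value p ZZ YY c fhat n d \<xi> x = d3ro_objective p YY c fhat n d \<xi> x z"
  using assms unfolding d3ro_value_def is_arg_min_linorder
  by (intro antisym INF_lower INF_greatest) auto

text \<open>The conditional law itself belongs to the ambiguity set, and by integrability its
  extended expectation is the true cost, one of the values under the supremum.\<close>

lemma true_cost_le_d3ro_objective:
  assumes "prob_space S" and eps: "eps \<in> borel_measurable S" and c: "c z \<in> borel_measurable borel"
    and int: "integrable S (\<lambda>s. c z (fstar x z + eps s))"
    and YY: "closed YY" "AE s in S. fstar x z + eps s \<in> YY"
    and W: "wasserstein p (cond_law S eps fstar x z) (P_ER YY fhat n d x z) \<le> ennreal \<xi>"
  shows "ereal (true_cost S eps fstar c z x) \<le> d3ro_objective p YY c fhat n d \<xi> x z"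
proof -
  interpret S: prob_space S by fact
  let ?Q = "cond_law S eps fstar x z"
  have m: "(\<lambda>s. fstar x z + eps s) \<in> borel_measurable S" using eps by measurable
  interpret Q: prob_space ?Q unfolding cond_law_def by (rule S.prob_space_distr[OF m])
  have "AE y in ?Q. y \<in> YY"
    using YY eps by (simp add: AE_cond_law_iff)
  then have "emeasure ?Q YY = 1"
    using YY(1) by (intro Q.emeasure_eq_1_AE) auto
  then have "?Q \<in> ambiguity_set p YY fhat n d x z \<xi>"
    using W Q.prob_space_axioms by (auto simp: ambiguity_set_def prob_on_def)
  moreover have "ext_expectation ?Q (c z) = ereal (true_cost S eps fstar c z x)"
    using c int unfolding cond_law_def true_cost_def
    by (subst ext_expectation_eq) (simp_all add: integrable_distr_eq[OF m] integral_distr[OF m])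
  ultimately show ?thesis
    unfolding d3ro_objective_def by (metis SUP_upper)
qed

section \<open>Probability of the certificate event\<close>

theorem theorem3p3:
  fixes S :: "'s measure" and M :: "'w measure"
    and X :: "'s \<Rightarrow> real^'x" and Z :: "'s \<Rightarrow> real^'z" and Y eps :: "'s \<Rightarrow> real^'y"
    and fstar :: "real^'x \<Rightarrow> real^'z \<Rightarrow> real^'y"
    and XX :: "(real^'x) set" and ZZ :: "(real^'z) set" and YY :: "(real^'y) set"
    and D :: "nat \<Rightarrow> 'w \<Rightarrow> ('x, 'z, 'y) obs"
    and c :: "real^'z \<Rightarrow> real^'y \<Rightarrow> real"
    and n :: nat and p \<alpha> c1 c2 c3 :: real
    and fhat :: "('x, 'z, 'y) sample \<Rightarrow> real^'x \<Rightarrow> real^'z \<Rightarrow> real^'y"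
    and \<kappa>x :: "real \<Rightarrow> real^'x \<Rightarrow> real" and \<kappa> :: "real \<Rightarrow> real"
    and \<xi> :: "real^'x \<Rightarrow> real"
    and zhat :: "real^'x \<Rightarrow> ('x, 'z, 'y) sample \<Rightarrow> real^'z"
  assumes setting: "regression_model S M X Z Y eps fstar XX ZZ YY D"
    and n: "1 \<le> n" and p: "1 \<le> p" and \<alpha>: "0 < \<alpha>" "\<alpha> < 1"
    and cost_measurable: "\<And>z. z \<in> ZZ \<Longrightarrow> c z \<in> borel_measurable borel"
    and true_cost_finite:
      "\<And>x z. x \<in> XX \<Longrightarrow> z \<in> ZZ \<Longrightarrow> integrable S (\<lambda>s. c z (fstar x z + eps s))"
    and true_problem_solvable:
      "\<And>x. x \<in> XX \<Longrightarrow> \<exists>z. is_arg_min (\<lambda>z. true_cost S eps fstar c z x) (\<lambda>z. z \<in> ZZ) z"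
    and fhat_measurable:
      "(\<lambda>(d, x, z). fhat d x z) \<in> borel_measurable (sample_space n \<Otimes>\<^sub>M borel \<Otimes>\<^sub>M borel)"
    and regression_x:
      "AE x in distr S borel X. \<forall>\<alpha>'\<in>{0<..<1}. 0 < \<kappa>x \<alpha>' x \<and>
         (\<forall>\<zeta>\<in>data_driven_decisions n ZZ.
            measure M {\<omega> \<in> space M. norm (fstar x (\<zeta> (sample_of n D \<omega>))
                - fhat (sample_of n D \<omega>) x (\<zeta> (sample_of n D \<omega>))) powr p > \<kappa>x \<alpha>' x powr p} \<le> \<alpha>')"
    and regression_in_sample:
      "\<forall>\<alpha>'\<in>{0<..<1}. 0 < \<kappa> \<alpha>' \<and>
         measure M {\<omega> \<in> space M. (1 / real n) * (\<Sum>k=1..n.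
             norm (fstar (obs_x (D k \<omega>)) (obs_z (D k \<omega>))
               - fhat (sample_of n D \<omega>) (obs_x (D k \<omega>)) (obs_z (D k \<omega>))) powr p) > \<kappa> \<alpha>' powr p} \<le> \<alpha>'"
    and constants: "0 < c1" "0 < c2" "0 < c3"
    and concentration:
      "\<And>r m x z. 0 < r \<Longrightarrow> 1 \<le> m \<Longrightarrow> x \<in> XX \<Longrightarrow> z \<in> ZZ \<Longrightarrow>
         {\<omega> \<in> space M. wasserstein p (P_star fstar m (sample_of m D \<omega>) x z)
             (cond_law S eps fstar x z) \<ge> ennreal r} \<in> sets M \<and>
         measure M {\<omega> \<in> space M. wasserstein p (P_star fstar m (sample_of m D \<omega>) x z)
             (cond_law S eps fstar x z) \<ge> ennreal r}
           \<le> c1 * exp (- c2 * real m * r powr c3)"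
    and radius: "\<And>x. \<xi> x = \<kappa>x (\<alpha> / 4) x + \<kappa> (\<alpha> / 4)
                   + (ln (2 * c1 / \<alpha>) / (c2 * real n)) powr (1 / c3)"
    and objective_real_lsc:
      "\<And>x. x \<in> XX \<Longrightarrow> AE \<omega> in M.
         (\<forall>z\<in>ZZ. \<bar>d3ro_objective p YY c fhat n (sample_of n D \<omega>) (\<xi> x) x z\<bar> \<noteq> \<infinity>) \<and>
         lsc_on ZZ (d3ro_objective p YY c fhat n (sample_of n D \<omega>) (\<xi> x) x)"
    and zhat_decision: "\<And>x. x \<in> XX \<Longrightarrow> zhat x \<in> data_driven_decisions n ZZ"
    and zhat_optimal:
      "\<And>x. x \<in> XX \<Longrightarrow> AE \<omega> in M.
         is_arg_min (d3ro_objective p YY c fhat n (sample_of n D \<omega>) (\<xi> x) x) (\<lambda>z. z \<in> ZZ)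
           (zhat x (sample_of n D \<omega>))"
    and certificate_event:
      "\<And>x. x \<in> XX \<Longrightarrow>
         {\<omega> \<in> space M. ereal (true_cost S eps fstar c (zhat x (sample_of n D \<omega>)) x)
             \<le> d3ro_value p ZZ YY c fhat n (sample_of n D \<omega>) (\<xi> x) x} \<in> sets M"
  shows "AE x in distr S borel X.
           measure M {\<omega> \<in> space M. ereal (true_cost S eps fstar c (zhat x (sample_of n D \<omega>)) x)
               \<le> d3ro_value p ZZ YY c fhat n (sample_of n D \<omega>) (\<xi> x) x} \<ge> 1 - \<alpha>"
proof -
  interpret regression_model S M X Z Y eps fstar XX ZZ YY D by (rule setting)
  have sample[measurable]: "sample_of n D \<in> M \<rightarrow>\<^sub>M sample_space n"
    unfolding sample_space_def sample_of_def
    by (rule measurable_restrict) (auto intro: data_rv)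
  \<comment> \<open>The estimate is evaluated at points that are themselves random, hence the use of
    joint measurability in sample and point.\<close>
  have fhat_m: "(\<lambda>\<omega>. fhat (sample_of n D \<omega>) (h1 \<omega>) (h2 \<omega>)) \<in> borel_measurable M"
    if [measurable]: "h1 \<in> borel_measurable M" "h2 \<in> borel_measurable M" for h1 h2
  proof -
    have "(\<lambda>\<omega>. (sample_of n D \<omega>, h1 \<omega>, h2 \<omega>)) \<in> M \<rightarrow>\<^sub>M sample_space n \<Otimes>\<^sub>M borel \<Otimes>\<^sub>M borel"
      by measurable
    from measurable_compose[OF this fhat_measurable] show ?thesis by simp
  qed
  have fstar_m: "(\<lambda>\<omega>. fstar (h1 \<omega>) (h2 \<omega>)) \<in> borel_measurable M"
    if "h1 \<in> borel_measurable M" "h2 \<in> borel_measurable M" for h1 h2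
    using measurable_compose[OF borel_measurable_Pair[OF that] fstar_meas] by simp
  have D_m: "(\<lambda>\<omega>. obs_x (D k \<omega>)) \<in> borel_measurable M" "(\<lambda>\<omega>. obs_z (D k \<omega>)) \<in> borel_measurable M"
    if "1 \<le> k" for k
    using data_rv[OF that] unfolding borel_prod[symmetric] by measurable
  have \<alpha>4: "\<alpha> / 4 \<in> {0<..<1}" using \<alpha> by auto
  \<comment> \<open>The concentration bound is used at this one decision, which does not depend on
    the sample.\<close>
  obtain z0 where z0: "z0 \<in> ZZ" using ZZ(2) by auto
  define in_err where "in_err \<omega> = (1 / real n) * (\<Sum>k=1..n.
             norm (fstar (obs_x (D k \<omega>)) (obs_z (D k \<omega>))
               - fhat (sample_of n D \<omega>) (obs_x (D k \<omega>)) (obs_z (D k \<omega>))) powr p)" for \<omega>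
  have [measurable]: "in_err \<in> borel_measurable M"
    unfolding in_err_def using fstar_m fhat_m D_m
    by (intro borel_measurable_times borel_measurable_sum powr_real_measurable borel_measurable_norm
        borel_measurable_diff) auto
  \<comment> \<open>A bad event that does not involve \<open>x\<close>, so it is treated before
    \<open>x\<close> is fixed.\<close>
  define B2 where "B2 = {\<omega> \<in> space M. in_err \<omega> > \<kappa> (\<alpha> / 4) powr p}"
  have B2: "B2 \<in> M.events" "M.prob B2 \<le> \<alpha> / 4" "0 < \<kappa> (\<alpha> / 4)"
    using bspec[OF regression_in_sample \<alpha>4, folded in_err_def] by (auto simp: B2_def)
  \<comment> \<open>For a nonnegative logarithm this solves
    \<open>c1 * exp (- c2 * real n * r powr c3) = \<alpha> / 2\<close> for \<open>r\<close>.\<close>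
  define r0 where "r0 = (ln (2 * c1 / \<alpha>) / (c2 * real n)) powr (1 / c3)"
  have r0: "0 \<le> r0" by (simp add: r0_def)
  have exp_bound: "c1 * exp (- c2 * real n * r powr c3) \<le> \<alpha> / 2" if "r0 < r" for r
  proof -
    \<comment> \<open>The logarithm may be negative; the bound then does not depend on the value of \<open>powr\<close>
      at a negative base.\<close>
    have "ln (2 * c1 / \<alpha>) \<le> c2 * real n * r powr c3"
    proof (cases "0 \<le> ln (2 * c1 / \<alpha>)")
      case True
      then have "ln (2 * c1 / \<alpha>) / (c2 * real n) = r0 powr c3"
        using constants n by (simp add: r0_def powr_powr)
      also have "\<dots> \<le> r powr c3" using constants that r0 by (intro powr_mono2) auto
      finally show ?thesis using constants n by (simp add: field_simps)
    next
      case False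
      moreover have "0 \<le> c2 * real n * r powr c3" using constants(2) by simp
      ultimately show ?thesis by linarith
    qed
    then have "- c2 * real n * r powr c3 \<le> - ln (2 * c1 / \<alpha>)" by linarith
    then have "exp (- c2 * real n * r powr c3) \<le> exp (- ln (2 * c1 / \<alpha>))"
      by (simp only: exp_le_cancel_iff)
    also have "\<dots> = \<alpha> / (2 * c1)" using \<alpha> constants by (simp add: exp_minus)
    finally show ?thesis using constants by (simp add: field_simps)
  qed
  have "AE x in distr S borel X. x \<in> XX"
    unfolding XX using AE_in_rv_support[OF S.prob_space_axioms X_rv] .
  with regression_x show ?thesis
  proof eventually_elim
    case (elim x)
    note x = \<open>x \<in> XX\<close>
    define d where "d = sample_of n D"
    define \<zeta> where "\<zeta> \<omega> = zhat x (d \<omega>)" for \<omega>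
    define E where "E = {\<omega> \<in> space M. ereal (true_cost S eps fstar c (\<zeta> \<omega>) x)
             \<le> d3ro_value p ZZ YY c fhat n (d \<omega>) (\<xi> x) x}"
    have E: "E \<in> M.events" using certificate_event[OF x] by (simp add: E_def d_def \<zeta>_def)
    have zhat_m: "zhat x \<in> borel_measurable (sample_space n)"
      and zhat_ZZ: "\<And>d. d \<in> space (sample_space n) \<Longrightarrow> zhat x d \<in> ZZ"
      using zhat_decision[OF x] by (auto simp: data_driven_decisions_def)
    have \<zeta>_m: "\<zeta> \<in> borel_measurable M"
      unfolding \<zeta>_def d_def by (rule measurable_compose[OF sample zhat_m])
    define B1 where "B1 = {\<omega> \<in> space M. norm (fstar x (\<zeta> \<omega>) - fhat (d \<omega>) x (\<zeta> \<omega>)) powr p > \<kappa>x (\<alpha> / 4) x powr p}"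
    have \<kappa>x: "0 < \<kappa>x (\<alpha> / 4) x" using elim(1) \<alpha>4 by blast
    have "(\<lambda>\<omega>. fstar x (\<zeta> \<omega>)) \<in> borel_measurable M"
      "(\<lambda>\<omega>. fhat (d \<omega>) x (\<zeta> \<omega>)) \<in> borel_measurable M"
      unfolding d_def by (intro fstar_m fhat_m \<zeta>_m borel_measurable_const)+
    then have B1: "B1 \<in> M.events"
      unfolding B1_def by (intro borel_measurable_less powr_real_measurable borel_measurable_diff
        measurable_compose[OF _ borel_measurable_norm] borel_measurable_const)
    \<comment> \<open>\<open>zhat x\<close> is an admissible data-driven rule, so the regression
      bound applies at the minimiser itself.\<close>
    have B1_le: "M.prob B1 \<le> \<alpha> / 4"
      using bspec[OF conjunct2[OF bspec[OF elim(1) \<alpha>4]] zhat_decision[OF x]]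
      unfolding B1_def d_def \<zeta>_def .
    define W where "W \<omega> = wasserstein p (P_star fstar n (d \<omega>) x z0) (cond_law S eps fstar x z0)" for \<omega>
    \<comment> \<open>The last summand \<open>r0\<close> of the radius may vanish, whereas \<open>concentration\<close> needs a positive
      radius, hence the approximation of \<open>r0\<close> from above.\<close>
    define B where "B k = {\<omega> \<in> space M. W \<omega> \<ge> ennreal (r0 + 1 / real (Suc k))}" for k
    have B: "B k \<in> M.events" "M.prob (B k) \<le> \<alpha> / 2" for k
    proof -
      have r: "0 < r0 + 1 / real (Suc k)" "r0 < r0 + 1 / real (Suc k)" using r0 by (auto simp: add_nonneg_pos)
      note conc = concentration[OF r(1) n x z0, folded d_def, folded W_def, folded B_def]
      show "B k \<in> M.events" by (rule conjunct1[OF conc])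
      show "M.prob (B k) \<le> \<alpha> / 2" by (rule order_trans[OF conjunct2[OF conc] exp_bound[OF r(2)]])
    qed
    \<comment> \<open>This union is the event that \<open>W\<close> exceeds \<open>r0\<close>;
      continuity from below keeps the bound \<open>\<alpha> / 2\<close>.\<close>
    define B3 where "B3 = (\<Union>k. B k)"
    have "incseq B"
    proof (rule incseq_SucI)
      fix k
      have "ennreal (r0 + 1 / real (Suc (Suc k))) \<le> ennreal (r0 + 1 / real (Suc k))"
        by (intro ennreal_leI add_left_mono frac_le) auto
      then show "B k \<le> B (Suc k)" by (auto simp: B_def intro: order_trans)
    qed
    then have "(\<lambda>k. M.prob (B k)) \<longlonglongrightarrow> M.prob B3"
      unfolding B3_def using B(1) by (intro M.finite_Lim_measure_incseq) auto
    then have B3: "M.prob B3 \<le> \<alpha> / 2"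
      by (rule LIMSEQ_le_const2) (use B(2) in blast)
    have B3_event: "B3 \<in> M.events" unfolding B3_def using B(1) by blast
    \<comment> \<open>The inclusion holds only almost surely, since \<open>zhat\<close> is optimal
      only almost surely.\<close>
    have "AE \<omega> in M. \<omega> \<in> space M - E \<longrightarrow> \<omega> \<in> B1 \<union> B2 \<union> B3"
      using zhat_optimal[OF x] AE_space
    proof eventually_elim
      case (elim \<omega>)
      have "\<omega> \<in> E" if good: "\<omega> \<notin> B1" "\<omega> \<notin> B2" "\<omega> \<notin> B3"
      proof -
        have \<zeta>: "\<zeta> \<omega> \<in> ZZ"
          unfolding \<zeta>_def d_def using elim(2) by (intro zhat_ZZ measurable_space[OF sample])
        have "norm (fstar x (\<zeta> \<omega>) - fhat (d \<omega>) x (\<zeta> \<omega>)) powr p \<le> \<kappa>x (\<alpha> / 4) x powr p"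
          using good(1) elim(2) by (auto simp: B1_def not_less)
        then have at_x: "norm (fstar x (\<zeta> \<omega>) - fhat (d \<omega>) x (\<zeta> \<omega>)) \<le> \<kappa>x (\<alpha> / 4) x"
          using powr_less_mono2[of p "\<kappa>x (\<alpha> / 4) x" "norm (fstar x (\<zeta> \<omega>) - fhat (d \<omega>) x (\<zeta> \<omega>))"] p \<kappa>x
          by fastforce
        have "in_err \<omega> \<le> \<kappa> (\<alpha> / 4) powr p"
          using good(2) elim(2) by (auto simp: B2_def not_less)
        \<comment> \<open>\<open>sample_of\<close> agrees with \<open>D\<close> only on the indices
          \<open>{1..n}\<close>, which are exactly those of the sum.\<close>
        moreover have "in_err \<omega> = (1 / real n) * (\<Sum>k=1..n. norm (fstar (obs_x (d \<omega> k)) (obs_z (d \<omega> k))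
            - fhat (d \<omega>) (obs_x (d \<omega> k)) (obs_z (d \<omega> k))) powr p)"
          unfolding in_err_def d_def by (intro arg_cong2[of _ _ _ _ "(*)"] sum.cong) (auto simp: sample_of_def)
        ultimately have in_s: "(1 / real n) * (\<Sum>k=1..n. norm (fstar (obs_x (d \<omega> k)) (obs_z (d \<omega> k))
            - fhat (d \<omega>) (obs_x (d \<omega> k)) (obs_z (d \<omega> k))) powr p) \<le> \<kappa> (\<alpha> / 4) powr p" by simp
        have supp: "AE s in S. fstar x (\<zeta> \<omega>) + eps s \<in> YY" by (rule cond_law_on[OF x \<zeta>])
        then have law: "AE y in cond_law S eps fstar x (\<zeta> \<omega>). y \<in> YY"
          by (simp only: AE_cond_law_iff[OF eps_rv borel_closed[OF YY(3)]])
        have "wasserstein p (cond_law S eps fstar x (\<zeta> \<omega>)) (P_ER YY fhat n (d \<omega>) x (\<zeta> \<omega>))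
            \<le> ennreal (\<kappa>x (\<alpha> / 4) x + \<kappa> (\<alpha> / 4) + (r0 + 1 / real (Suc k)))" for k
        proof (rule wasserstein_P_ER[of n p _ _ _ YY _ fstar x "\<zeta> \<omega>" fhat "d \<omega>",
              OF n p \<kappa>x B2(3) _ YY(3,4,2) sets_cond_law law at_x in_s])
          show "0 < r0 + 1 / real (Suc k)" using r0 by (auto simp: add_nonneg_pos)
          have "wasserstein p (P_star fstar n (d \<omega>) x (\<zeta> \<omega>)) (cond_law S eps fstar x (\<zeta> \<omega>)) \<le> W \<omega>"
            unfolding W_def using p eps_rv by (intro wasserstein_P_star_translate) auto
          also have "\<dots> < ennreal (r0 + 1 / real (Suc k))"
            using good(3) elim(2) by (auto simp: B3_def B_def not_le)
          finally show "wasserstein p (P_star fstar n (d \<omega>) x (\<zeta> \<omega>)) (cond_law S eps fstar x (\<zeta> \<omega>))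
            < ennreal (r0 + 1 / real (Suc k))" .
        qed
        \<comment> \<open>The distance does not depend on \<open>k\<close>, so letting
          \<open>k\<close> grow removes the slack \<open>1 / real (Suc k)\<close> and leaves the
          exact radius.\<close>
        moreover have "(\<lambda>k. ennreal (\<kappa>x (\<alpha> / 4) x + \<kappa> (\<alpha> / 4) + (r0 + 1 / real (Suc k))))
            \<longlonglongrightarrow> ennreal (\<kappa>x (\<alpha> / 4) x + \<kappa> (\<alpha> / 4) + (r0 + 0))"
          by (intro tendsto_ennrealI tendsto_add tendsto_const) (rule LIMSEQ_Suc[OF lim_1_over_n])
        ultimately have "wasserstein p (cond_law S eps fstar x (\<zeta> \<omega>)) (P_ER YY fhat n (d \<omega>) x (\<zeta> \<omega>))
            \<le> ennreal (\<xi> x)"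
          unfolding radius r0_def[symmetric] by (intro LIMSEQ_le_const) (auto simp del: of_nat_Suc)
        then have "ereal (true_cost S eps fstar c (\<zeta> \<omega>) x) \<le> d3ro_objective p YY c fhat n (d \<omega>) (\<xi> x) x (\<zeta> \<omega>)"
          by (intro true_cost_le_d3ro_objective S.prob_space_axioms eps_rv cost_measurable \<zeta>
              true_cost_finite x YY(3) supp)
        \<comment> \<open>Optimality of the decision turns the objective at
          \<open>\<zeta> \<omega>\<close> into the optimal value.\<close>
        also have "\<dots> = d3ro_value p ZZ YY c fhat n (d \<omega>) (\<xi> x) x"
          using elim(1) unfolding \<zeta>_def d_def by (intro d3ro_value_eq[symmetric])
        finally show ?thesis using elim(2) by (simp add: E_def)
      qed
      then show ?case by auto
    qed
    then have "M.prob (space M - E) \<le> M.prob (B1 \<union> B2 \<union> B3)"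
      using B1 B2(1) B3_event by (intro M.finite_measure_mono_AE) auto
    also have "\<dots> \<le> M.prob B1 + M.prob B2 + M.prob B3"
      using measure_Un_le[OF sets.Un[OF B1 B2(1)] B3_event] measure_Un_le[OF B1 B2(1)] by linarith
    also have "\<dots> \<le> \<alpha>" using B1_le B2(2) B3 by simp
    finally show "1 - \<alpha> \<le> M.prob {\<omega> \<in> space M. ereal (true_cost S eps fstar c (zhat x (sample_of n D \<omega>)) x)
             \<le> d3ro_value p ZZ YY c fhat n (sample_of n D \<omega>) (\<xi> x) x}"
      unfolding E_def[unfolded \<zeta>_def d_def, symmetric] using M.prob_compl[OF E] by linarith
  qed
qed

end
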